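(* Let $p, t_1, t_2$ be integers with $0 < t_i < p$ for $i=1,2$, and let $\mathcal{P} = PG(p-1,2)$. Then: (a) If $t_1 + t_2 \le p$, then there exist a $(t_1-1)$-dimensional projective subspace $S_1$ and a $(t_2-1)$-dimensional projective subspace $S_2$ of $\mathcal{P}$ such that $S_1 \cap S_2 = \emptyset$. (b) If $t_1 + t_2 > p$, then for every $(t_1-1)$-dimensional projective subspace $S_1$ and every $(t_2-1)$-dimensional projective subspace $S_2$ of $\mathcal{P}$ one has $|S_1 \cap S_2| \ge 2^{t_1+t_2-p} - 1$, and there exist such $S_1$ and $S_2$ for which equality holds.
   Context: $PG(p-1,2)$ denotes the $(p-1)$-dimensional projective geometry over $GF(2)$; its set of points is identified with the set of nonzero vectors of $GF(2)^p$, so it has $2^p-1$ points. A $(t-1)$-dimensional projective subspace of $PG(p-1,2)$ is the set of nonzero vectors of a $t$-dimensional linear subspace of $GF(2)^p$; it has $2^t-1$ points. Intersections and cardinalities refer to these sets of points (the zero vector is never included). *)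

theory Defs
  imports "HOL-Analysis.Analysis" "HOL-Library.Z2"
begin

text \<open>
  The type \<^typ>\<open>bit\<close> is the field GF(2), so \<open>bit ^ 'p\<close> is the vector space \<open>GF(2)\<^sup>p\<close> with
  \<open>p = CARD('p)\<close>. Over GF(2) every one-dimensional subspace contains exactly one nonzero
  vector, so the points of \<open>PG(p-1,2)\<close> are identified with the nonzero vectors.
\<close>

definition PG_points :: "(bit ^ 'p::finite) set" where
  "PG_points = {v. v \<noteq> 0}"

text \<open>The number \<open>d\<close> is the projective dimension, one less than the linear dimension.\<close>

definition projective_subspace :: "nat \<Rightarrow> (bit ^ 'p::finite) set \<Rightarrow> bool" where
  "projective_subspace d S \<longleftrightarrow>
     (\<exists>W. vec.subspace W \<and> vec.dim W = d + 1 \<and> S = W \<inter> PG_points)"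

end

theory Submission
  imports Defs
begin

text \<open>
  A \<open>d\<close>-dimensional linear subspace of \<open>GF(2)\<^sup>p\<close> has \<open>2\<^sup>d\<close> elements, so the bound in (b) is
  the dimension formula for \<open>W\<^sub>1 + W\<^sub>2\<close> and \<open>W\<^sub>1 \<inter> W\<^sub>2\<close>. In (a) and for equality in (b) take
  coordinate subspaces supported on index sets that overlap as little as possible.
\<close>

text \<open>Over an infinite field both cardinalities are the junk value \<open>0\<close> unless \<open>B\<close> is empty.\<close>

lemma card_span_independent:
  fixes B :: "('a::field ^ 'n) set"
  assumes "vec.independent B"
  shows "card (vec.span B) = CARD('a) ^ card B"
proof -
  have "finite B"
    using assms by (rule vec.finiteI_independent)
  then show ?thesis
    using assms
  proof (induction B rule: finite_induct)
    case empty
    then show ?case by simp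
  next
    case (insert b B)
    have b: "b \<notin> vec.span B" and ind: "vec.independent B"
      using insert.prems insert.hyps by (simp_all add: vec.independent_insert)
    \<comment> \<open>Every vector of the enlarged span is \<open>k *s b + x\<close> for exactly one
      scalar \<open>k\<close> and one \<open>x\<close> in \<open>vec.span B\<close>, so adjoining
      \<open>b\<close> multiplies the cardinality by \<open>CARD('a)\<close>.\<close>
    let ?f = "\<lambda>(k, x). k *s b + x"
    have "inj_on ?f (UNIV \<times> vec.span B)"
    proof (intro inj_onI, clarsimp)
      fix k l x y
      assume x: "x \<in> vec.span B" and y: "y \<in> vec.span B"
        and eq: "k *s b + x = l *s b + y"
      have "(k - l) *s b = y - x"
        using eq by (simp add: vec.scale_left_diff_distrib algebra_simps)
      then have "(k - l) *s b \<in> vec.span B"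
        using x y by (simp add: vec.span_diff)
      \<comment> \<open>If \<open>k - l\<close> were nonzero, multiplying by its inverse would put
        \<open>b\<close> into \<open>vec.span B\<close>.\<close>
      then have "k = l"
        using b vec.span_scale[of "(k - l) *s b" B "inverse (k - l)"]
        by (metis left_inverse right_minus_eq vector_smult_assoc vector_smult_lid)
      then show "k = l \<and> x = y"
        using eq by simp
    qed
    moreover have "vec.span (insert b B) = ?f ` (UNIV \<times> vec.span B)"
    proof
      show "vec.span (insert b B) \<subseteq> ?f ` (UNIV \<times> vec.span B)"
      proof
        fix x assume "x \<in> vec.span (insert b B)"
        then obtain k where "x - k *s b \<in> vec.span B"
          by (auto simp: vec.span_insert)
        then show "x \<in> ?f ` (UNIV \<times> vec.span B)"
          by (intro image_eqI[of _ _ "(k, x - k *s b)"]) auto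
      qed
      show "?f ` (UNIV \<times> vec.span B) \<subseteq> vec.span (insert b B)"
        by (auto intro!: vec.span_add vec.span_scale intro: vec.span_base vec.span_mono[THEN subsetD, OF subset_insertI])
    qed
    ultimately show ?case
      using insert.IH[OF ind] insert.hyps
      by (simp add: card_image card_cartesian_product)
  qed
qed

lemma card_subspace:
  fixes W :: "('a::field ^ 'n) set"
  assumes "vec.subspace W"
  shows "card W = CARD('a) ^ vec.dim W"
proof -
  obtain B where "vec.independent B" "vec.span B = W" "card B = vec.dim W"
    using assms by (metis vec.basis_exists vec.span_subspace)
  then show ?thesis
    using card_span_independent by metis
qed

lemma UNIV_bit: "(UNIV :: bit set) = {0, 1}"
  by (auto intro: bit.exhaust)

lemma CARD_bit: "CARD(bit) = 2"
  by (simp add: UNIV_bit)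

text \<open>Passing to points removes exactly the zero vector, which every linear subspace
  contains.\<close>

lemma card_subspace_Int_PG_points:
  fixes W :: "(bit ^ 'p::finite) set"
  assumes "vec.subspace W"
  shows "card (W \<inter> PG_points) = 2 ^ vec.dim W - 1"
proof -
  have "W \<inter> PG_points = W - {0}"
    by (auto simp: PG_points_def)
  then show ?thesis
    using card_subspace[OF assms] vec.subspace_0[OF assms] by (simp add: CARD_bit)
qed

text \<open>This is the dimension formula for \<open>V + W\<close> and \<open>V \<inter> W\<close>,
  combined with the fact that \<open>V + W\<close> lies in a space of dimension
  \<open>CARD('n)\<close>.\<close>

lemma dim_Int_ge:
  fixes V W :: "('a::field ^ 'n) set"
  assumes "vec.subspace V" "vec.subspace W"
  shows "vec.dim V + vec.dim W - CARD('n) \<le> vec.dim (V \<inter> W)"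
  using vec.dim_sums_Int[OF assms] dim_subset_UNIV_cart_gen[of "{x + y |x y. x \<in> V \<and> y \<in> W}"]
  by linarith

definition coord_subspace :: "'n set \<Rightarrow> ('a::field ^ 'n) set" where
  "coord_subspace A = {x. \<forall>i. i \<notin> A \<longrightarrow> x $ i = 0}"

lemma subspace_coord_subspace: "vec.subspace (coord_subspace A)"
  by (auto simp: coord_subspace_def vec.subspace_def)

lemma dim_coord_subspace: "vec.dim (coord_subspace A) = card A"
  unfolding coord_subspace_def by (rule dim_substandard_cart)

lemma coord_subspace_Int: "coord_subspace A \<inter> coord_subspace B = coord_subspace (A \<inter> B)"
  by (auto simp: coord_subspace_def)

text \<open>Positivity of \<open>card A\<close> ensures that the truncated \<open>card A - 1\<close>
  plus one gives back the linear dimension \<open>card A\<close>.\<close>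

lemma projective_subspace_coord_subspace:
  fixes A :: "'p::finite set"
  assumes "0 < card A"
  shows "projective_subspace (card A - 1) (coord_subspace A \<inter> PG_points)"
  unfolding projective_subspace_def
  using assms subspace_coord_subspace dim_coord_subspace by fastforce

lemma card_Int_coord_subspaces:
  fixes A B :: "'p::finite set"
  shows "card ((coord_subspace A \<inter> PG_points) \<inter> (coord_subspace B \<inter> PG_points)) = 2 ^ card (A \<inter> B) - 1"
proof -
  have "(coord_subspace A \<inter> PG_points) \<inter> (coord_subspace B \<inter> PG_points)
      = coord_subspace (A \<inter> B) \<inter> (PG_points :: (bit ^ 'p) set)"
    by (auto simp flip: coord_subspace_Int)
  then show ?thesis
    by (simp add: card_subspace_Int_PG_points subspace_coord_subspace dim_coord_subspace)
qed

text \<open>Truncated subtraction lets one statement cover both regimes: disjoint sets if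
  \<open>m + n \<le> card U\<close>, and otherwise the overlap that inclusion-exclusion
  forces.\<close>

lemma ex_subsets_minimal_overlap:
  assumes "finite U" "m \<le> card U" "n \<le> card U"
  obtains A B where "A \<subseteq> U" "B \<subseteq> U" "card A = m" "card B = n" "card (A \<inter> B) = m + n - card U"
proof -
  obtain A where A: "A \<subseteq> U" "card A = m"
    using assms by (meson obtain_subset_with_card_n)
  have finA: "finite A"
    using A assms(1) finite_subset by blast
  have compl: "card (U - A) = card U - m"
    using A finA by (simp add: card_Diff_subset)
  show thesis
  proof (cases "n \<le> card (U - A)")
    case True
    then obtain B where B: "B \<subseteq> U - A" "card B = n"
      by (meson obtain_subset_with_card_n)
    then have "A \<inter> B = {}"
      by blast
    then show thesis
      using that[of A B] A B True compl assms by auto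
  next
    case False
    \<comment> \<open>Here the complement of \<open>A\<close> is too small for \<open>B\<close>, so
      \<open>B\<close> takes all of it and borrows the missing elements \<open>C\<close> from
      \<open>A\<close>; these form the whole overlap.\<close>
    then obtain C where C: "C \<subseteq> A" "card C = n - card (U - A)"
      using obtain_subset_with_card_n[of "n - card (U - A)" A] A compl assms by force
    have "card ((U - A) \<union> C) = card (U - A) + card C"
      using C finA assms(1) by (intro card_Un_disjoint) (auto intro: finite_subset)
    moreover have "A \<inter> ((U - A) \<union> C) = C"
      using C by blast
    ultimately show thesis
      using that[of A "(U - A) \<union> C"] A C False compl assms by auto
  qed
qed

theorem theorem6:
  fixes p t1 t2 :: nat
  assumes "p = CARD('p::finite)"
    and "0 < t1" "t1 < p"
    and "0 < t2" "t2 < p"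
  shows
    "(t1 + t2 \<le> p \<longrightarrow>
       (\<exists>S1 S2 :: (bit ^ 'p) set.
          projective_subspace (t1 - 1) S1 \<and> projective_subspace (t2 - 1) S2 \<and>
          S1 \<inter> S2 = {})) \<and>
     (t1 + t2 > p \<longrightarrow>
       (\<forall>S1 S2 :: (bit ^ 'p) set.
          projective_subspace (t1 - 1) S1 \<and> projective_subspace (t2 - 1) S2 \<longrightarrow>
          card (S1 \<inter> S2) \<ge> 2 ^ (t1 + t2 - p) - 1) \<and>
       (\<exists>S1 S2 :: (bit ^ 'p) set.
          projective_subspace (t1 - 1) S1 \<and> projective_subspace (t2 - 1) S2 \<and>
          card (S1 \<inter> S2) = 2 ^ (t1 + t2 - p) - 1))"
proof -
  \<comment> \<open>One pair of index sets serves both (a) and the equality in (b).\<close>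
  obtain A B :: "'p set" where AB: "card A = t1" "card B = t2" "card (A \<inter> B) = t1 + t2 - p"
    using ex_subsets_minimal_overlap[of "UNIV :: 'p set" t1 t2] assms by auto
  define S1 S2 :: "(bit ^ 'p) set"
    where "S1 = coord_subspace A \<inter> PG_points" and "S2 = coord_subspace B \<inter> PG_points"
  have S: "projective_subspace (t1 - 1) S1" "projective_subspace (t2 - 1) S2"
    using projective_subspace_coord_subspace[of A] projective_subspace_coord_subspace[of B] AB assms
    by (simp_all add: S1_def S2_def)
  have card_S: "card (S1 \<inter> S2) = 2 ^ (t1 + t2 - p) - 1"
    unfolding S1_def S2_def using AB by (simp only: card_Int_coord_subspaces)
  have disjoint: "S1 \<inter> S2 = {}" if "t1 + t2 \<le> p"
  proof -
    \<comment> \<open>For \<open>t1 + t2 \<le> p\<close> the cardinality is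
      \<open>2 ^ 0 - 1 = 0\<close>. Finiteness is needed to conclude emptiness, since infinite sets
      also have \<open>card\<close> equal to 0; it follows here from the positive cardinality of the
      whole space.\<close>
    have "finite (UNIV :: (bit ^ 'p) set)"
      using card_subspace[of "UNIV :: (bit ^ 'p) set"] by (auto intro: card_ge_0_finite simp: CARD_bit)
    then have "finite (S1 \<inter> S2)"
      by (rule finite_subset[OF subset_UNIV])
    then show ?thesis
      using card_S that by simp
  qed
  have bound: "2 ^ (t1 + t2 - p) - 1 \<le> card (T1 \<inter> T2)"
    if T: "projective_subspace (t1 - 1) T1" "projective_subspace (t2 - 1) T2"
    for T1 T2 :: "(bit ^ 'p) set"
  proof -
    obtain V W where V: "vec.subspace V" "vec.dim V = t1" "T1 = V \<inter> PG_points"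
      and W: "vec.subspace W" "vec.dim W = t2" "T2 = W \<inter> PG_points"
      using T assms by (auto simp: projective_subspace_def)
    have "T1 \<inter> T2 = (V \<inter> W) \<inter> PG_points"
      using V W by blast
    then have "card (T1 \<inter> T2) = 2 ^ vec.dim (V \<inter> W) - 1"
      using V W by (simp add: card_subspace_Int_PG_points vec.subspace_inter)
    \<comment> \<open>The bound on the exponent carries over to the point count because
      \<open>2 ^ d - 1\<close> is monotone in \<open>d\<close>.\<close>
    moreover have "t1 + t2 - p \<le> vec.dim (V \<inter> W)"
      using dim_Int_ge[of V W] V W assms(1) by simp
    ultimately show ?thesis
      by (simp add: diff_le_mono)
  qed
  show ?thesis
    using S card_S disjoint bound by blast
qed

end
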